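(* Let $A,B$ be matrices as in the context, let $E=E(\mathcal S(\Lambda_{A,B}))$ and let $\widehat E_{\mathrm{tight}}$ be its space of tight characters. Then the map $\Phi:\widehat E_{\mathrm{tight}}\to X_A$, $\Phi(\phi_\xi)=\widehat{\omega_\xi}$, is a homeomorphism of topological spaces.
   Context: Data. Let $N\in\{1,2,\dots\}\cup\{\infty\}$ and $V=\{1,\dots,N\}$ (all positive integers if $N=\infty$). $A$ is an $N\times N$ matrix with entries in $\{0,1,2,\dots\}$, $B$ an $N\times N$ matrix with entries in $\mathbb Z$, both row-finite. Put $\Omega_A=\{(i,j)\in V\times V: A_{i,j}\ge1\}$, $\Omega_A(i)=\{j:(i,j)\in\Omega_A\}$. Standing assumption: $\Omega_A(i)\neq\emptyset$ for all $i$, and $B_{i,j}=0$ whenever $(i,j)\notin\Omega_A$. Semigroupoid. $\Lambda=\Lambda_{A,B}$ is the semigroupoid (set with associative partial product) generated by symbols $h_i$ ($i\in V$) and $g_{i,j,n}$ ($(i,j)\in\Omega_A$, $n\in\mathbb Z$): its elements are nonempty words in which consecutive letters form one of the admissible pairs $(h_i,h_i)$, $(h_i,g_{i,j,n})$, $(g_{i,j,n},h_j)$, $(g_{i,j,n},g_{j,k,m})$, modulo the congruence generated by $g_{i,j,n}h_j=g_{i,j,n+A_{i,j}}$ and $h_ig_{i,j,n}=g_{i,j,n+B_{i,j}}$; the product is concatenation when admissible. $\Lambda^f=\{g: fg\text{ is defined}\}$. $f$ divides $m$, $f\mid m$, if $f=m$ or $fh=m$ for some $h\in\Lambda$; any two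 elements with a common multiple have a unique least common multiple (lcm); elements without a common multiple are disjoint. Semilattice. $E=E(\mathcal S(\Lambda))$ is the semilattice with zero consisting of $0$ and distinct elements $p_f$ ($f\in\Lambda$) and $q_{h_i}$ ($i\in V$), with: $p_fp_g=p_{\mathrm{lcm}(f,g)}$ if $f,g$ have a common multiple and $p_fp_g=0$ otherwise; $p_fq_{h_i}=p_f$ if $f\in\Lambda^{h_i}$ and $0$ otherwise; $q_{h_i}q_{h_j}=0$ for $i\ne j$. (It is the idempotent semilattice of the inverse semigroup $\mathcal S(\Lambda)$ of triples $(f,\Lambda^{h_i},g)$ associated to $\Lambda$, with $p_f=(f,\Lambda^f,f)$ and $q_{h_i}=(1,\Lambda^{h_i},1)$.) Tight characters. A filter $\xi\subset E$ is a nonempty, upward closed subset, closed under products, not containing $0$; its character $\phi_\xi:E\to\{0,1\}$ is its indicator function. The space of characters has the topology induced from $\{0,1\}^E$; $\widehat E_{\mathrm{tight}}$ is the closure of the set of characters of ultrafilters, and $\xi$ is a tight filter if $\phi_\xi\in\widehat E_{\mathrm{tight}}$. The stem of $\xi$ is $\omega_\xi=\{f\in\Lambda:p_f\in\xi\}$. Infinite paths. $X_A$ is the set of infinite sequences $g_{i_1,i_2,n_1}g_{i_2,i_3,n_2}\cdots$ with $(i_k,i_{k+1})\in\Omega_A$, $1\le n_k\le A_{i_k,i_{k+1}}$ for all $k$, with the topology having as basis the cylinder sets $W_n^\gamma=\{\tau\in X_A:\tau|_n=\gamma|_n\}$ ($\gamma\in X_A$, $n\ge1$; $\gamma|_n$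 is the product of the first $n$ letters). For a tight filter $\xi$ there is a unique $\widehat{\omega_\xi}\in X_A$ such that $\widehat{\omega_\xi}|_k\in\omega_\xi$ for all $k\ge1$. *)

theory Defs
  imports "HOL-Analysis.Analysis"
begin

datatype letter = H nat | G nat nat int

text \<open>Elements of the semilattice of idempotents: \<open>P f\<close> is \<open>p_f\<close> and \<open>Q i\<close> is \<open>q_{h_i}\<close>;
  elements of the semigroupoid are congruence classes of words.\<close>

datatype idem = Zero | P "letter list set" | Q nat

fun follows :: "letter \<Rightarrow> letter \<Rightarrow> bool" where
  "follows (H i) (H j) \<longleftrightarrow> j = i"
| "follows (H i) (G j k n) \<longleftrightarrow> j = i"
| "follows (G i j n) (H k) \<longleftrightarrow> k = j"
| "follows (G i j n) (G k l m) \<longleftrightarrow> k = j"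

text \<open>The values of \<open>A\<close> and \<open>B\<close> outside \<open>V \<times> V\<close>, where \<open>V = {1, ..., N}\<close>, are irrelevant:
  no definition below depends on them.\<close>

locale katsura_data =
  fixes N :: enat
    and A :: "nat \<Rightarrow> nat \<Rightarrow> nat"
    and B :: "nat \<Rightarrow> nat \<Rightarrow> int"
  assumes N_pos: "N \<ge> 1"
    and row_finite_A: "\<And>i. 1 \<le> i \<Longrightarrow> enat i \<le> N \<Longrightarrow> finite {j. 1 \<le> j \<and> enat j \<le> N \<and> A i j \<noteq> 0}"
    and row_finite_B: "\<And>i. 1 \<le> i \<Longrightarrow> enat i \<le> N \<Longrightarrow> finite {j. 1 \<le> j \<and> enat j \<le> N \<and> B i j \<noteq> 0}"
    and row_nonzero: "\<And>i. 1 \<le> i \<Longrightarrow> enat i \<le> N \<Longrightarrow> \<exists>j. 1 \<le> j \<and> enat j \<le> N \<and> A i j \<ge> 1"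
    and B_zero: "\<And>i j. 1 \<le> i \<Longrightarrow> enat i \<le> N \<Longrightarrow> 1 \<le> j \<Longrightarrow> enat j \<le> N \<Longrightarrow> A i j = 0 \<Longrightarrow> B i j = 0"
begin

definition V :: "nat set" where
  "V = {i. 1 \<le> i \<and> enat i \<le> N}"

definition Omega :: "(nat \<times> nat) set" where
  "Omega = {(i, j). i \<in> V \<and> j \<in> V \<and> A i j \<ge> 1}"

subsection \<open>The semigroupoid\<close>

definition letters :: "letter set" where
  "letters = {H i | i. i \<in> V} \<union> {G i j n | i j n. (i, j) \<in> Omega}"

definition words :: "letter list set" where
  "words = {w. w \<noteq> [] \<and> set w \<subseteq> letters \<and> successively follows w}"

inductive word_eq :: "letter list \<Rightarrow> letter list \<Rightarrow> bool" where
  gh: "(i, j) \<in> Omega \<Longrightarrow> word_eq [G i j n, H j] [G i j (n + int (A i j))]"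
| hg: "(i, j) \<in> Omega \<Longrightarrow> word_eq [H i, G i j n] [G i j (n + B i j)]"
| refl: "u \<in> words \<Longrightarrow> word_eq u u"
| sym: "word_eq u v \<Longrightarrow> word_eq v u"
| trans: "word_eq u v \<Longrightarrow> word_eq v w \<Longrightarrow> word_eq u w"
| left: "word_eq u v \<Longrightarrow> w @ u \<in> words \<Longrightarrow> w @ v \<in> words \<Longrightarrow> word_eq (w @ u) (w @ v)"
| right: "word_eq u v \<Longrightarrow> u @ w \<in> words \<Longrightarrow> v @ w \<in> words \<Longrightarrow> word_eq (u @ w) (v @ w)"

definition cls :: "letter list \<Rightarrow> letter list set" where
  "cls w = {v. word_eq w v}"

definition Lambda :: "letter list set set" where
  "Lambda = words // {(u, v). word_eq u v}"

text \<open>\<open>composable\<close> and \<open>mult\<close> (the partial product) do not depend on the chosen representatives: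
  see \<open>composable_cls\<close> and \<open>mult_cls\<close> below.\<close>

definition composable :: "letter list set \<Rightarrow> letter list set \<Rightarrow> bool" where
  "composable f g \<longleftrightarrow> f \<in> Lambda \<and> g \<in> Lambda \<and> (\<exists>u\<in>f. \<exists>v\<in>g. u @ v \<in> words)"

definition mult :: "letter list set \<Rightarrow> letter list set \<Rightarrow> letter list set" where
  "mult f g = (\<Union>u\<in>f. \<Union>v\<in>g. if u @ v \<in> words then cls (u @ v) else {})"

definition Lambda_sup :: "letter list set \<Rightarrow> letter list set set" where
  "Lambda_sup f = {g \<in> Lambda. composable f g}"

definition divides :: "letter list set \<Rightarrow> letter list set \<Rightarrow> bool" where
  "divides f m \<longleftrightarrow> f = m \<or> (\<exists>h\<in>Lambda. composable f h \<and> mult f h = m)"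

definition common_multiple :: "letter list set \<Rightarrow> letter list set \<Rightarrow> letter list set \<Rightarrow> bool" where
  "common_multiple f g m \<longleftrightarrow> m \<in> Lambda \<and> divides f m \<and> divides g m"

definition least_common_multiple :: "letter list set \<Rightarrow> letter list set \<Rightarrow> letter list set" where
  "least_common_multiple f g =
     (THE m. common_multiple f g m \<and> (\<forall>m'. common_multiple f g m' \<longrightarrow> divides m m'))"

subsection \<open>The semilattice of idempotents and its tight characters\<close>

definition E :: "idem set" where
  "E = {Zero} \<union> {P f | f. f \<in> Lambda} \<union> {Q i | i. i \<in> V}"

fun meet :: "idem \<Rightarrow> idem \<Rightarrow> idem" where
  "meet Zero y = Zero"
| "meet x Zero = Zero"
| "meet (P f) (P g) = (if \<exists>m. common_multiple f g m then P (least_common_multiple f g) else Zero)"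
| "meet (P f) (Q i) = (if f \<in> Lambda_sup (cls [H i]) then P f else Zero)"
| "meet (Q i) (P f) = (if f \<in> Lambda_sup (cls [H i]) then P f else Zero)"
| "meet (Q i) (Q j) = (if i = j then Q i else Zero)"

definition is_filter :: "idem set \<Rightarrow> bool" where
  "is_filter \<xi> \<longleftrightarrow> \<xi> \<subseteq> E \<and> \<xi> \<noteq> {} \<and> Zero \<notin> \<xi> \<and>
     (\<forall>x\<in>\<xi>. \<forall>y\<in>E. meet x y = x \<longrightarrow> y \<in> \<xi>) \<and>
     (\<forall>x\<in>\<xi>. \<forall>y\<in>\<xi>. meet x y \<in> \<xi>)"

definition is_ultrafilter :: "idem set \<Rightarrow> bool" where
  "is_ultrafilter \<xi> \<longleftrightarrow> is_filter \<xi> \<and> (\<forall>\<eta>. is_filter \<eta> \<longrightarrow> \<xi> \<subseteq> \<eta> \<longrightarrow> \<eta> = \<xi>)"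

definition character :: "idem set \<Rightarrow> idem \<Rightarrow> nat" where
  "character \<xi> = (\<lambda>e\<in>E. if e \<in> \<xi> then 1 else 0)"

definition character_space :: "(idem \<Rightarrow> nat) topology" where
  "character_space = subtopology (product_topology (\<lambda>_. discrete_topology {0, 1}) E)
     {character \<xi> | \<xi>. is_filter \<xi>}"

text \<open>The closure is taken inside the space of characters: the zero function may be a limit of
  ultrafilter characters in \<open>{0, 1}\<^sup>E\<close>, but it is not a character.\<close>

definition E_tight :: "(idem \<Rightarrow> nat) set" where
  "E_tight = character_space closure_of {character \<xi> | \<xi>. is_ultrafilter \<xi>}"

definition tight_space :: "(idem \<Rightarrow> nat) topology" where
  "tight_space = subtopology character_space E_tight"

definition stem :: "idem set \<Rightarrow> letter list set set" where
  "stem \<xi> = {f \<in> Lambda. P f \<in> \<xi>}"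

subsection \<open>Infinite paths\<close>

text \<open>A path is indexed from \<open>0\<close>, so \<open>\<gamma> k\<close> is its \<open>(k + 1)\<close>-st letter.\<close>

definition X_A :: "(nat \<Rightarrow> letter) set" where
  "X_A = {\<gamma>. \<exists>i n. \<forall>k. \<gamma> k = G (i k) (i (Suc k)) (n k) \<and> (i k, i (Suc k)) \<in> Omega \<and>
                 1 \<le> n k \<and> n k \<le> int (A (i k) (i (Suc k)))}"

text \<open>The product in the semigroupoid of the first \<open>n\<close> letters; meaningful for \<open>n \<ge> 1\<close> only.\<close>

definition path_prefix :: "(nat \<Rightarrow> letter) \<Rightarrow> nat \<Rightarrow> letter list set" where
  "path_prefix \<gamma> n = cls (map \<gamma> [0..<n])"

definition cylinder :: "nat \<Rightarrow> (nat \<Rightarrow> letter) \<Rightarrow> (nat \<Rightarrow> letter) set" where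
  "cylinder n \<gamma> = {\<tau> \<in> X_A. path_prefix \<tau> n = path_prefix \<gamma> n}"

text \<open>Prefixes are compared in the semigroupoid.  The cylinders form a base (any two are nested or
  disjoint), so the topology generated by them consists of their unions.\<close>

definition path_space :: "(nat \<Rightarrow> letter) topology" where
  "path_space = topology_generated_by {cylinder n \<gamma> | n \<gamma>. n \<ge> 1 \<and> \<gamma> \<in> X_A}"

definition stem_path :: "letter list set set \<Rightarrow> nat \<Rightarrow> letter" where
  "stem_path \<omega> = (THE \<gamma>. \<gamma> \<in> X_A \<and> (\<forall>k\<ge>1. path_prefix \<gamma> k \<in> \<omega>))"

text \<open>A character determines its filter as the preimage of \<open>1\<close>.\<close>

definition Phi :: "(idem \<Rightarrow> nat) \<Rightarrow> nat \<Rightarrow> letter" where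
  "Phi \<phi> = stem_path (stem {e \<in> E. \<phi> e = 1})"

subsection \<open>Consistency of the encoding\<close>

lemma Phi_character: "is_filter \<xi> \<Longrightarrow> Phi (character \<xi>) = stem_path (stem \<xi>)"
proof -
  assume "is_filter \<xi>"
  then have "{e \<in> E. character \<xi> e = 1} = \<xi>"
    by (auto simp: is_filter_def character_def)
  then show ?thesis by (simp add: Phi_def)
qed

lemma topspace_path_space: "topspace path_space = X_A"
proof -
  have "\<gamma> \<in> cylinder 1 \<gamma>" if "\<gamma> \<in> X_A" for \<gamma>
    using that by (simp add: cylinder_def)
  moreover have "cylinder n \<gamma> \<subseteq> X_A" for n \<gamma>
    by (auto simp: cylinder_def)
  ultimately have "\<Union> {cylinder n \<gamma> | n \<gamma>. n \<ge> 1 \<and> \<gamma> \<in> X_A} = X_A"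
    by blast
  then show ?thesis by (simp add: path_space_def)
qed

lemma topspace_tight_space: "topspace tight_space = E_tight"
  unfolding tight_space_def E_tight_def
  by (rule topspace_subtopology_subset) (rule closure_of_subset_topspace)

lemma topspace_character_space: "topspace character_space = {character \<xi> | \<xi>. is_filter \<xi>}"
  by (auto simp: character_space_def character_def split: if_splits)

definition src :: "letter list \<Rightarrow> nat" where
  "src w = (case hd w of H i \<Rightarrow> i | G i j n \<Rightarrow> i)"

definition tgt :: "letter list \<Rightarrow> nat" where
  "tgt w = (case last w of H i \<Rightarrow> i | G i j n \<Rightarrow> j)"

lemma append_in_words:
  assumes "u \<in> words" "v \<in> words"
  shows "u @ v \<in> words \<longleftrightarrow> tgt u = src v"
proof -
  have "follows a b \<longleftrightarrow> tgt [a] = src [b]" for a b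
    by (cases a; cases b) (auto simp: src_def tgt_def)
  then show ?thesis
    using assms by (auto simp: words_def successively_append_iff src_def tgt_def)
qed

lemma word_eq_invariants:
  "word_eq u v \<Longrightarrow> u \<in> words \<and> v \<in> words \<and> src u = src v \<and> tgt u = tgt v"
proof (induction rule: word_eq.induct)
  case (left u v w)
  then show ?case by (cases w) (auto simp: src_def tgt_def words_def)
next
  case (right u v w)
  then show ?case by (cases w) (auto simp: src_def tgt_def words_def)
qed (auto simp: src_def tgt_def words_def letters_def Omega_def)

lemma equiv_word_eq: "equiv words {(u, v). word_eq u v}"
proof (rule equivI)
  show "{(u, v). word_eq u v} \<subseteq> words \<times> words"
    using word_eq_invariants by blast
  show "refl_on words {(u, v). word_eq u v}"
    by (auto simp: refl_on_def intro: word_eq.refl)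
  show "sym {(u, v). word_eq u v}"
    by (auto simp: sym_def dest: word_eq.sym)
  show "trans {(u, v). word_eq u v}"
    by (auto simp: trans_def dest: word_eq.trans)
qed

lemma Lambda_eq: "Lambda = cls ` words"
  by (auto simp: Lambda_def quotient_def cls_def)

lemma cls_eq_iff:
  assumes "u \<in> words" "v \<in> words"
  shows "cls u = cls v \<longleftrightarrow> word_eq u v"
  using eq_equiv_class_iff[OF equiv_word_eq assms] by (simp add: cls_def Image_singleton)

lemma word_eq_append:
  assumes "word_eq u u'" "word_eq v v'" "u @ v \<in> words"
  shows "u' @ v' \<in> words" "word_eq (u @ v) (u' @ v')"
proof -
  note i = word_eq_invariants[OF assms(1)] word_eq_invariants[OF assms(2)]
  have a: "u' @ v \<in> words" and b: "u' @ v' \<in> words"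
    using assms(3) i by (auto simp: append_in_words)
  show "u' @ v' \<in> words" by fact
  show "word_eq (u @ v) (u' @ v')"
    using word_eq.right[OF assms(1,3) a] word_eq.left[OF assms(2) a b] by (rule word_eq.trans)
qed

lemma composable_cls:
  assumes "u \<in> words" "v \<in> words"
  shows "composable (cls u) (cls v) \<longleftrightarrow> u @ v \<in> words"
proof
  assume "composable (cls u) (cls v)"
  then obtain u' v' where "word_eq u u'" "word_eq v v'" "u' @ v' \<in> words"
    by (auto simp: composable_def cls_def)
  then show "u @ v \<in> words"
    using word_eq_append(1)[OF word_eq.sym word_eq.sym] by blast
next
  assume "u @ v \<in> words"
  moreover have "u \<in> cls u" "v \<in> cls v"
    using assms by (simp_all add: cls_def word_eq.refl)
  ultimately show "composable (cls u) (cls v)"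
    using assms unfolding composable_def Lambda_eq by blast
qed

lemma mult_cls:
  assumes "u \<in> words" "v \<in> words" "u @ v \<in> words"
  shows "mult (cls u) (cls v) = cls (u @ v)"
proof
  show "mult (cls u) (cls v) \<subseteq> cls (u @ v)"
  proof
    fix x assume "x \<in> mult (cls u) (cls v)"
    then obtain u' v' where *: "word_eq u u'" "word_eq v v'" "word_eq (u' @ v') x"
      by (auto simp: mult_def cls_def split: if_splits)
    show "x \<in> cls (u @ v)"
      using word_eq.trans[OF word_eq_append(2)[OF *(1,2) assms(3)] *(3)] by (simp add: cls_def)
  qed
  have "u \<in> cls u" "v \<in> cls v"
    using assms by (simp_all add: cls_def word_eq.refl)
  then show "cls (u @ v) \<subseteq> mult (cls u) (cls v)"
    using assms(3) unfolding mult_def by fastforce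
qed

end

end

theory Submission
  imports Defs "HOL-Library.Sublist"
begin

text \<open>The letter \<open>h\<close> acts like an adding machine.  Moving every \<open>h\<close> to the right, and using
  \<open>g\<^bsub>i,j,n\<^esub> h\<^sub>j = g\<^bsub>i,j,n+A\<^esub>\<close> to reduce \<open>n\<close> to the range \<open>1, ..., A\<^bsub>i,j\<^esub>\<close>, one can write every
  element of \<open>\<Lambda>\<close> uniquely as \<open>a h\<^sup>q\<close>, where \<open>a\<close> is a finite path of reduced letters and \<open>q\<close> is an
  integer (positive if \<open>a\<close> is empty): see \<open>cls_eq_iff_normal_form\<close>.  Multiplication on the right
  either prolongs \<open>a\<close>, and then any \<open>q\<close> can be reached, or keeps \<open>a\<close> and increases \<open>q\<close>.  So
  divisibility is the lexicographic order given by the prefix order on \<open>a\<close> and the order of the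
  integers \<open>q\<close> (\<open>divides_iff_normal_form\<close>).  The divisors of an element therefore form a chain: two
  elements have a common multiple only if one divides the other, and their lcm is then the larger
  one.

  Hence a filter is essentially a chain in a forest.  Such a chain always lies along some infinite
  path \<open>\<gamma>\<close>.  All \<open>p\<^sub>f\<close> such that \<open>f\<close> starts at the source of \<open>\<gamma>\<close> and its reduced path is a prefix of
  \<open>\<gamma>\<close>, together with \<open>q\<^bsub>h\<^esub>\<close> for that source, already form a filter (\<open>path_filter\<close>), and none of these
  filters contains another, so they are exactly the ultrafilters (\<open>is_ultrafilter_iff\<close>).  An ultrafilter
  that contains a finite path contains one of its prolongations by a reduced edge.  As \<open>A\<close> is
  row-finite there are finitely many of these, so the property is closed and passes to every tight
  filter (\<open>tight_edge\<close>).  A tight filter thus contains arbitrarily long paths, which forces it to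
  be one of the ultrafilters (\<open>E_tight_eq\<close>).

  So \<open>\<gamma> \<mapsto> path_filter \<gamma>\<close> is inverse to \<open>\<Phi>\<close>.  Both maps are continuous: a cylinder is the
  condition that one \<open>p\<^sub>f\<close> lies in the filter, and conversely whether a given idempotent lies in
  \<open>path_filter \<gamma>\<close> depends only on finitely many letters of \<open>\<gamma>\<close>.\<close>

context katsura_data
begin

section \<open>Normal forms in the semigroupoid\<close>

text \<open>A word is read from left to right; the state \<open>(a, q)\<close> stands for \<open>a h\<^sup>q\<close>.  From
  \<open>h\<^sup>q g\<^bsub>i,j,n\<^esub> = g\<^bsub>i,j,n+qB\<^esub>\<close> and \<open>n + qB = r + q'A\<close> with \<open>1 \<le> r \<le> A\<close> one gets
  \<open>a h\<^sup>q g\<^bsub>i,j,n\<^esub> = a g\<^bsub>i,j,r\<^esub> h\<^bsup>q'\<^esup>\<close>; the shift by one in \<open>mod\<close> and \<open>div\<close> puts \<open>r\<close> into the range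
  \<open>1, ..., A\<close> instead of \<open>0, ..., A - 1\<close>.\<close>

fun step :: "letter \<Rightarrow> letter list \<times> int \<Rightarrow> letter list \<times> int" where
  "step (H i) (a, q) = (a, q + 1)"
| "step (G i j n) (a, q) =
     (a @ [G i j ((n + q * B i j - 1) mod int (A i j) + 1)], (n + q * B i j - 1) div int (A i j))"

abbreviation run :: "letter list \<Rightarrow> letter list \<times> int \<Rightarrow> letter list \<times> int" where
  "run \<equiv> fold step"

definition path :: "letter list \<Rightarrow> letter list" where
  "path w = fst (run w ([], 0))"

definition carry :: "letter list \<Rightarrow> int" where
  "carry w = snd (run w ([], 0))"

lemma Omega_pos: "(i, j) \<in> Omega \<Longrightarrow> A i j > 0"
  by (simp add: Omega_def)

text \<open>Quantifying over the initial state makes compatibility with left and right multiplication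
  trivial, so that only the two generating relations have to be compared.\<close>

lemma word_eq_run: "word_eq u v \<Longrightarrow> run u s = run v s"
proof (induction arbitrary: s rule: word_eq.induct)
  case (gh i j n)
  obtain a q where s: "s = (a, q)" by fastforce
  have *: "n + int (A i j) + q * B i j - 1 = (n + q * B i j - 1) + int (A i j)" by simp
  show ?case using Omega_pos[OF gh] by (simp add: s *)
next
  case (hg i j n)
  obtain a q where s: "s = (a, q)" by fastforce
  have *: "n + B i j + q * B i j = n + (q + 1) * B i j" by (simp add: algebra_simps)
  show ?case by (simp add: s *)
qed simp_all

text \<open>The reason why division is a lexicographic comparison: right multiplication can lower the
  carry only at the price of a longer path.\<close>

lemma run_extends:
  "run w (a, q) = (a, q + int (length w)) \<or> (\<exists>b q'. b \<noteq> [] \<and> run w (a, q) = (a @ b, q'))"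
proof (induction w rule: rev_induct)
  case (snoc x w)
  then show ?case
  proof (elim disjE exE conjE)
    assume "run w (a, q) = (a, q + int (length w))"
    then show ?thesis by (cases x) simp_all
  next
    fix b q' assume "b \<noteq> []" "run w (a, q) = (a @ b, q')"
    then show ?thesis by (cases x) simp_all
  qed
qed simp

lemma words_snoc_induct [consumes 1, case_names single snoc]:
  assumes "u \<in> words"
    and single: "\<And>x. x \<in> letters \<Longrightarrow> R [x]"
    and snoc: "\<And>w x. w \<in> words \<Longrightarrow> x \<in> letters \<Longrightarrow> tgt w = src [x] \<Longrightarrow> w @ [x] \<in> words \<Longrightarrow> R w \<Longrightarrow> R (w @ [x])"
  shows "R u"
  using assms(1)
proof (induction u rule: rev_induct)
  case Nil
  then show ?case by (simp add: words_def)
next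
  case (snoc x w)
  show ?case
  proof (cases "w = []")
    case True
    then show ?thesis using snoc.prems single by (simp add: words_def)
  next
    case False
    with snoc.prems have wx: "w \<in> words" "[x] \<in> words" "x \<in> letters"
      by (auto simp: words_def successively_append_iff)
    then have "tgt w = src [x]" using append_in_words[OF wx(1,2)] snoc.prems by simp
    then show ?thesis using assms(3) wx snoc by blast
  qed
qed

lemma tgt_snoc [simp]: "tgt (w @ [H i]) = i" "tgt (w @ [G i j n]) = j" "tgt [H i] = i" "tgt [G i j n] = j"
  by (simp_all add: tgt_def)

lemma src_Cons [simp]: "src (H i # w) = i" "src (G i j n # w) = i"
  by (simp_all add: src_def)

lemma src_append [simp]: "u \<noteq> [] \<Longrightarrow> src (u @ v) = src u"
  by (simp add: src_def)

lemma tgt_append [simp]: "v \<noteq> [] \<Longrightarrow> tgt (u @ v) = tgt v"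
  by (simp add: tgt_def)

lemma words_nonempty: "w \<in> words \<Longrightarrow> w \<noteq> []"
  by (simp add: words_def)

lemma letters_H [simp]: "H i \<in> letters \<longleftrightarrow> i \<in> V" and letters_G [simp]: "G i j n \<in> letters \<longleftrightarrow> (i, j) \<in> Omega"
  by (auto simp: letters_def)

lemma singleton_words [simp]: "[x] \<in> words \<longleftrightarrow> x \<in> letters"
  by (simp add: words_def)

lemma Omega_V: "(i, j) \<in> Omega \<Longrightarrow> i \<in> V \<and> j \<in> V"
  by (simp add: Omega_def)

text \<open>Reduced paths together with their end points.  The empty walk at \<open>i\<close> is included: it is the
  path part of the powers of \<open>h\<^sub>i\<close>.\<close>

inductive walk :: "nat \<Rightarrow> letter list \<Rightarrow> nat \<Rightarrow> bool" where
  walk_Nil: "i \<in> V \<Longrightarrow> walk i [] i"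
| walk_snoc: "walk i a j \<Longrightarrow> (j, k) \<in> Omega \<Longrightarrow> 1 \<le> n \<Longrightarrow> n \<le> int (A j k) \<Longrightarrow> walk i (a @ [G j k n]) k"

lemma walk_in_V: "walk i a j \<Longrightarrow> i \<in> V \<and> j \<in> V"
  by (induction rule: walk.induct) (auto dest: Omega_V)

lemma walk_NilD: "walk i [] j \<Longrightarrow> j = i"
  by (auto elim: walk.cases)

lemma walk_snocE:
  assumes "walk i (a @ [x]) k"
  obtains j n where "x = G j k n" "walk i a j" "(j, k) \<in> Omega" "1 \<le> n" "n \<le> int (A j k)"
  using assms by (auto elim: walk.cases)

lemma walk_words: "walk i a j \<Longrightarrow> a \<noteq> [] \<Longrightarrow> a \<in> words \<and> src a = i \<and> tgt a = j"
proof (induction rule: walk.induct)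
  case (walk_snoc i a j k n)
  show ?case
  proof (cases "a = []")
    case True
    then show ?thesis using walk_snoc walk_NilD by auto
  next
    case False
    then show ?thesis using walk_snoc append_in_words[of a "[G j k n]"] by auto
  qed
qed simp

lemma walk_appendE:
  assumes "walk i (a @ b) j"
  obtains k where "walk i a k" "walk k b j"
proof -
  have "\<exists>k. walk i a k \<and> walk k b j" using assms
  proof (induction b arbitrary: j rule: rev_induct)
    case Nil
    then show ?case using walk_in_V walk_Nil by auto
  next
    case (snoc x b)
    then have "walk i ((a @ b) @ [x]) j" by simp
    then show ?case using snoc.IH walk_snoc by (blast elim: walk_snocE)
  qed
  then show thesis using that by blast
qed

lemma run_walk: "walk i a j \<Longrightarrow> run a (b, 0) = (b @ a, 0)"
proof (induction rule: walk.induct)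
  case (walk_snoc i a j k n)
  then have "(n - 1) mod int (A j k) = n - 1" "(n - 1) div int (A j k) = 0" by simp_all
  then show ?case using walk_snoc by simp
qed simp

lemma path_walk: "walk i a j \<Longrightarrow> path a = a"
  by (simp add: path_def run_walk)

lemma run_start: "run w ([], 0) = (path w, carry w)"
  by (simp add: path_def carry_def)

lemma path_Nil [simp]: "path [] = []" and carry_Nil [simp]: "carry [] = 0"
  by (simp_all add: path_def carry_def)

lemma run_snoc: "run (w @ [x]) ([], 0) = step x (path w, carry w)"
  by (simp add: run_start)

lemma path_snoc [simp]:
  "path (w @ [H i]) = path w"
  "path (w @ [G i j n]) = path w @ [G i j ((n + carry w * B i j - 1) mod int (A i j) + 1)]"
  unfolding path_def[of "_ @ _"] run_snoc by simp_all

lemma carry_snoc [simp]: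
  "carry (w @ [H i]) = carry w + 1"
  "carry (w @ [G i j n]) = (n + carry w * B i j - 1) div int (A i j)"
  unfolding carry_def[of "_ @ _"] run_snoc by simp_all

lemmas path_single [simp] = path_snoc[of "[]", simplified] carry_snoc[of "[]", simplified]

lemma walk_snoc_path:
  assumes "walk i (path w) j" "(j, k) \<in> Omega"
  shows "walk i (path (w @ [G j k n])) k"
proof -
  have "int (A j k) > 0" using Omega_pos[OF assms(2)] by simp
  from pos_mod_bound[OF this] pos_mod_sign[OF this] show ?thesis
    by (auto intro!: walk_snoc assms simp: add1_zle_eq)
qed

lemma walk_path: "u \<in> words \<Longrightarrow> walk (src u) (path u) (tgt u)"
proof (induction rule: words_snoc_induct)
  case (single x)
  then show ?case
  proof (cases x)
    case (G i j n)
    then show ?thesis using single walk_snoc_path[of i "[]" i j n] walk_Nil Omega_V by auto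
  qed (auto intro: walk_Nil)
next
  case (snoc w x)
  then show ?case
  proof (cases x)
    case (G i j n)
    then show ?thesis using snoc walk_snoc_path[of "src w" w i j n] words_nonempty by auto
  qed (auto simp: words_nonempty)
qed

lemma carry_pos: "u \<in> words \<Longrightarrow> path u = [] \<Longrightarrow> carry u \<ge> 1"
proof (induction rule: words_snoc_induct)
  case (single x)
  then show ?case by (cases x) auto
next
  case (snoc w x)
  then show ?case by (cases x) auto
qed

fun shift :: "int \<Rightarrow> letter \<Rightarrow> letter" where
  "shift q (H i) = H i"
| "shift q (G i j n) = G i j (n + q * int (A i j))"

text \<open>A word that represents \<open>a h\<^sup>q\<close>.  The carry may be negative when \<open>a\<close> is not empty, so it is
  absorbed into the last letter rather than written as a power of \<open>h\<close>.\<close>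

definition canon :: "nat \<Rightarrow> letter list \<Rightarrow> int \<Rightarrow> letter list" where
  "canon i a q = (if a = [] then replicate (nat q) (H i) else butlast a @ [shift q (last a)])"

lemma word_eq_append_left:
  assumes "word_eq u v" "b @ u \<in> words"
  shows "word_eq (b @ u) (b @ v)"
proof (cases "b = []")
  case False
  with assms(2) have "b \<in> words" by (auto simp: words_def successively_append_iff)
  then show ?thesis using word_eq_append(2) assms word_eq.refl by blast
qed (use assms in simp)

lemma word_eq_refl_eq: "u \<in> words \<Longrightarrow> u = v \<Longrightarrow> word_eq u v"
  using word_eq.refl by blast

lemma absorb_H_power:
  assumes "(i, j) \<in> Omega"
  shows "word_eq (replicate c (H i) @ [G i j n]) [G i j (n + int c * B i j)]"
proof (induction c arbitrary: n)
  case 0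
  then show ?case using assms by (auto intro: word_eq.refl)
next
  case (Suc c)
  have eq: "replicate (Suc c) (H i) @ [G i j n] = replicate c (H i) @ [H i, G i j n]"
    by (simp add: replicate_append_same)
  have "word_eq (replicate c (H i) @ [H i, G i j n]) (replicate c (H i) @ [G i j (n + B i j)])"
  proof (rule word_eq_append_left[OF hg[OF assms]])
    show "replicate c (H i) @ [H i, G i j n] \<in> words"
      using assms Omega_V by (induction c) (auto simp: words_def successively_Cons hd_append)
  qed
  from word_eq.trans[OF this Suc] show ?case unfolding eq by (simp add: algebra_simps)
qed

text \<open>Writing \<open>g\<^bsub>r+A\<^esub> = g\<^sub>r h\<close> and letting the next letter absorb \<open>h\<close> moves one unit of carry
  past an inner vertex; the reverse step covers negative \<open>q\<close>.\<close>

lemma transfer_carry: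
  assumes "(l, i) \<in> Omega" "(i, j) \<in> Omega"
  shows "word_eq [G l i (r + q * int (A l i)), G i j n] [G l i r, G i j (n + q * B i j)]"
proof -
  have one: "word_eq [G l i (r + int (A l i)), G i j n] [G l i r, G i j (n + B i j)]" for r n
  proof -
    have w: "[G l i r, H i, G i j n] \<in> words"
      using assms Omega_V by (auto simp: words_def)
    have "word_eq ([G l i r, H i] @ [G i j n]) ([G l i (r + int (A l i))] @ [G i j n])"
      by (rule word_eq_append(2)[OF gh[OF assms(1)] word_eq.refl]) (use w assms in auto)
    moreover have "word_eq ([G l i r] @ [H i, G i j n]) ([G l i r] @ [G i j (n + B i j)])"
      by (rule word_eq_append_left[OF hg[OF assms(2)]]) (use w in simp)
    ultimately show ?thesis by simp (meson word_eq.sym word_eq.trans)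
  qed
  show ?thesis
  proof (induction q arbitrary: r n rule: int_induct[where k = 0])
    case base
    show ?case using assms by (auto intro!: word_eq.refl simp: words_def)
  next
    case (step1 q)
    show ?case using word_eq.trans[OF one[of "r + q * int (A l i)" n] step1(2)[of r "n + B i j"]]
      by (simp add: algebra_simps)
  next
    case (step2 q)
    have "word_eq [G l i (r + (q - 1) * int (A l i)), G i j n] [G l i (r + q * int (A l i)), G i j (n - B i j)]"
      using word_eq.sym[OF one[of "r + (q - 1) * int (A l i)" "n - B i j"]] by (simp add: algebra_simps)
    from word_eq.trans[OF this step2(2)] show ?case by (simp add: algebra_simps)
  qed
qed

lemma shift_rem_quot: "(m - 1) mod b + 1 + (m - 1) div b * b = (m :: int)"
  by (simp add: algebra_simps)

lemma word_eq_canon: "u \<in> words \<Longrightarrow> word_eq u (canon (src u) (path u) (carry u))"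
proof (induction rule: words_snoc_induct)
  case (single x)
  then show ?case
    by (cases x) (auto simp: canon_def shift_rem_quot intro!: word_eq.refl)
next
  case (snoc w x)
  let ?c = "canon (src w) (path w) (carry w)"
  have x: "word_eq [x] [x]" using snoc by (simp add: word_eq.refl)
  have 1: "word_eq (w @ [x]) (?c @ [x])" and cx: "?c @ [x] \<in> words"
    using word_eq_append[OF snoc(5) x] snoc by auto
  have "word_eq (?c @ [x]) (canon (src w) (path (w @ [x])) (carry (w @ [x])))"
  proof (cases "path w = []")
    case True
    then have tw: "tgt w = src w" using walk_path[OF snoc(1)] walk_NilD by simp
    have cw: "carry w \<ge> 1" using carry_pos snoc True by simp
    show ?thesis
    proof (cases x)
      case (H i)
      have "nat (carry w + 1) = Suc (nat (carry w))" using cw by simp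
      then show ?thesis using H tw snoc cx True
        by (intro word_eq_refl_eq) (auto simp: canon_def replicate_append_same)
    next
      case (G i j n)
      then show ?thesis using absorb_H_power[of i j "nat (carry w)" n] True cw tw snoc
        by (simp add: canon_def shift_rem_quot)
    qed
  next
    case False
    then obtain b y where p: "path w = b @ [y]" by (metis rev_exhaust)
    then obtain l r where y: "y = G l (tgt w) r" and O: "(l, tgt w) \<in> Omega"
      using walk_path[OF snoc(1)] by (auto elim: walk_snocE)
    let ?g = "G l (tgt w) (r + carry w * int (A l (tgt w)))"
    have c: "?c = b @ [?g]" by (simp add: canon_def p y)
    have cx': "b @ [?g, x] \<in> words" using cx c by simp
    show ?thesis
    proof (cases x)
      case (H i)
      with snoc have i: "i = tgt w" by simp
      have "word_eq (b @ [?g, x]) (b @ [G l (tgt w) (r + carry w * int (A l (tgt w)) + int (A l (tgt w)))])"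
        by (rule word_eq_append_left[OF _ cx']) (simp add: H i gh[OF O])
      then show ?thesis by (simp add: c canon_def H p y algebra_simps)
    next
      case (G i j n)
      with snoc have i: "i = tgt w" and O': "(i, j) \<in> Omega" by auto
      have "word_eq (b @ [?g, x]) (b @ [y, G i j (n + carry w * B i j)])"
        using transfer_carry[OF O O'[unfolded i]]
        by (intro word_eq_append_left[OF _ cx']) (simp add: G i y)
      then show ?thesis by (simp add: c canon_def G p y shift_rem_quot butlast_append)
    qed
  qed
  from word_eq.trans[OF 1 this] show ?case using snoc by (simp add: words_nonempty)
qed

theorem cls_eq_iff_normal_form:
  assumes "u \<in> words" "v \<in> words"
  shows "cls u = cls v \<longleftrightarrow> src u = src v \<and> path u = path v \<and> carry u = carry v"
proof
  assume "cls u = cls v"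
  then have *: "word_eq u v" using assms by (simp add: cls_eq_iff)
  show "src u = src v \<and> path u = path v \<and> carry u = carry v"
    using word_eq_invariants[OF *] word_eq_run[OF *] by (simp add: path_def carry_def)
next
  assume "src u = src v \<and> path u = path v \<and> carry u = carry v"
  then have "word_eq u v"
    using word_eq_canon[OF assms(1)] word_eq_canon[OF assms(2)] by (metis word_eq.sym word_eq.trans)
  then show "cls u = cls v" using assms by (simp add: cls_eq_iff)
qed

section \<open>Divisibility\<close>

text \<open>An arbitrary carry \<open>q'\<close> can be reached after at least one edge, because the letters
  \<open>g\<^bsub>i,j,n\<^esub>\<close> exist for all integers \<open>n\<close>: the first letter compensates the incoming carry \<open>q\<close>, the
  inner letters are produced with carry \<open>0\<close>, and the last one is chosen to leave \<open>q'\<close>.\<close>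

lemma word_prolonging_path:
  assumes "walk i b j" "b \<noteq> []"
  shows "\<exists>w\<in>words. src w = i \<and> tgt w = j \<and> run w (a, q) = (a @ b, q')"
  using assms
proof (induction arbitrary: q' rule: walk.induct)
  case (walk_snoc i b j k n)
  have euclid: "(n + q' * int (A j k) - 1) mod int (A j k) + 1 = n"
    "(n + q' * int (A j k) - 1) div int (A j k) = q'" for q'
  proof -
    have *: "n + q' * int (A j k) - 1 = (n - 1) + q' * int (A j k)" by simp
    have "(n - 1) mod int (A j k) = n - 1" "(n - 1) div int (A j k) = 0"
      using walk_snoc by simp_all
    then show "(n + q' * int (A j k) - 1) mod int (A j k) + 1 = n"
      "(n + q' * int (A j k) - 1) div int (A j k) = q'"
      unfolding * using Omega_pos[OF walk_snoc(2)] by simp_all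
  qed
  show ?case
  proof (cases "b = []")
    case True
    then have "j = i" using walk_snoc walk_NilD by simp
    then show ?thesis
      using walk_snoc(2) True euclid
      by (intro bexI[of _ "[G j k (n + q' * int (A j k) - q * B j k)]"]) simp_all
  next
    case False
    from walk_snoc.IH[OF False, of 0] obtain w
      where w: "w \<in> words" "src w = i" "tgt w = j" "run w (a, q) = (a @ b, 0)" by blast
    let ?x = "G j k (n + q' * int (A j k))"
    have "w @ [?x] \<in> words" using append_in_words[OF w(1), of "[?x]"] w walk_snoc by simp
    moreover have "src (w @ [?x]) = i" using w words_nonempty by simp
    moreover have "run (w @ [?x]) (a, q) = (a @ b @ [G j k n], q')" using w euclid by simp
    ultimately show ?thesis by (metis tgt_snoc(2))
  qed
qed simp

lemma path_append: "run v (path u, carry u) = (path (u @ v), carry (u @ v))"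
  by (simp add: path_def carry_def)

theorem divides_iff_normal_form:
  assumes u: "u \<in> words" and v: "v \<in> words"
  shows "divides (cls u) (cls v) \<longleftrightarrow>
    src u = src v \<and> (strict_prefix (path u) (path v) \<or> path u = path v \<and> carry u \<le> carry v)"
    (is "_ \<longleftrightarrow> ?R")
proof
  assume "divides (cls u) (cls v)"
  then consider "cls u = cls v" | h where "h \<in> words" "composable (cls u) (cls h)" "mult (cls u) (cls h) = cls v"
    by (auto simp: divides_def Lambda_eq)
  then show ?R
  proof cases
    case 1
    then show ?thesis using cls_eq_iff_normal_form[OF u v] by simp
  next
    case 2
    then have uh: "u @ h \<in> words" using composable_cls[OF u] by simp
    then have "cls (u @ h) = cls v" using mult_cls[OF u 2(1)] 2 by simp
    then have eq: "src v = src u" "path v = path (u @ h)" "carry v = carry (u @ h)"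
      using cls_eq_iff_normal_form[OF uh v] words_nonempty[OF u] by simp_all
    have "run h (path u, carry u) = (path v, carry v)" using eq path_append by simp
    then consider "path v = path u" "carry u \<le> carry v" | b where "b \<noteq> []" "path v = path u @ b"
      using run_extends[of h "path u" "carry u"] by fastforce
    then show ?thesis using eq(1) by cases (simp_all add: strict_prefix_def)
  qed
next
  assume R: ?R
  have divI: "divides (cls u) (cls v)"
    if h: "h \<in> words" "src h = tgt u" "run h (path u, carry u) = (path v, carry v)" for h
  proof -
    have uh: "u @ h \<in> words" using append_in_words[OF u h(1)] h by simp
    have "cls (u @ h) = cls v"
      using cls_eq_iff_normal_form[OF uh v] R h(3) path_append[of h u] words_nonempty[OF u] by simp
    then have "mult (cls u) (cls h) = cls v" using mult_cls[OF u h(1) uh] by simp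
    moreover have "cls h \<in> Lambda" using h by (simp add: Lambda_eq)
    moreover have "composable (cls u) (cls h)" using composable_cls[OF u h(1)] uh by simp
    ultimately show ?thesis by (auto simp: divides_def)
  qed
  have "(\<exists>b. b \<noteq> [] \<and> path v = path u @ b) \<or>
    path u = path v \<and> (carry u < carry v \<or> carry u = carry v)"
    using R unfolding order_le_less by (auto elim!: strict_prefixE')
  then consider b where "b \<noteq> []" "path v = path u @ b"
    | "path u = path v" "carry u < carry v" | "path u = path v" "carry u = carry v"
    by blast
  then show "divides (cls u) (cls v)"
  proof cases
    case 1
    have "walk (src u) (path u @ b) (tgt v)" using walk_path[OF v] R 1 by simp
    then obtain k where k: "walk (src u) (path u) k" "walk k b (tgt v)" by (rule walk_appendE)
    have "k = tgt u"
    proof (cases "path u = []")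
      case True
      then show ?thesis using k(1) walk_path[OF u] by (auto dest!: walk_NilD)
    next
      case False
      then show ?thesis using walk_words[OF k(1)] walk_words[OF walk_path[OF u]] by simp
    qed
    obtain w where "w \<in> words" "src w = k" "run w (path u, carry u) = (path u @ b, carry v)"
      using word_prolonging_path[OF k(2) 1(1)] by blast
    then show ?thesis using \<open>k = tgt u\<close> 1(2) by (intro divI[of w]) simp_all
  next
    case 2
    define d where "d = nat (carry v - carry u)"
    then have d: "d > 0" "carry v = carry u + int d" using 2 by simp_all
    have "src (replicate d (H i)) = i" for i using d(1) by (cases d) simp_all
    moreover have "replicate (Suc c) (H (tgt u)) \<in> words" for c
      using walk_in_V[OF walk_path[OF u]] by (induction c) (auto simp: words_def)
    then have "replicate d (H (tgt u)) \<in> words" using d(1) by (cases d) blast+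
    moreover have "run (replicate c (H i)) (a, q) = (a, q + int c)" for a q c i
      by (induction c arbitrary: q) simp_all
    ultimately show ?thesis using 2 d by (intro divI[of "replicate d (H (tgt u))"]) simp_all
  next
    case 3
    then show ?thesis using cls_eq_iff_normal_form[OF u v] R by (simp add: divides_def)
  qed
qed

lemma LambdaE:
  assumes "f \<in> Lambda" obtains u where "u \<in> words" "f = cls u"
  using assms by (auto simp: Lambda_eq)

lemma divides_refl: "divides f f"
  by (simp add: divides_def)

lemma divides_antisym:
  assumes "divides f g" "divides g f" "f \<in> Lambda" "g \<in> Lambda"
  shows "f = g"
proof -
  obtain u where u: "u \<in> words" "f = cls u" using assms(3) by (rule LambdaE)
  obtain v where v: "v \<in> words" "g = cls v" using assms(4) by (rule LambdaE)
  have "src u = src v"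
    and "strict_prefix (path u) (path v) \<or> path u = path v \<and> carry u \<le> carry v"
    and "strict_prefix (path v) (path u) \<or> path v = path u \<and> carry v \<le> carry u"
    using assms(1,2) u v by (simp_all only: divides_iff_normal_form)
  then have "path u = path v" "carry u = carry v"
    using prefix_order.less_not_sym by fastforce+
  with \<open>src u = src v\<close> show ?thesis using u v by (simp add: cls_eq_iff_normal_form)
qed

text \<open>Two prefixes of one list are comparable, and so are two integers.\<close>

lemma divisors_comparable:
  assumes "divides f m" "divides g m" "f \<in> Lambda" "g \<in> Lambda" "m \<in> Lambda"
  shows "divides f g \<or> divides g f"
proof -
  obtain u where u: "u \<in> words" "f = cls u" using assms(3) by (rule LambdaE)
  obtain v where v: "v \<in> words" "g = cls v" using assms(4) by (rule LambdaE)
  obtain w where w: "w \<in> words" "m = cls w" using assms(5) by (rule LambdaE)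
  have s: "src u = src v" and "prefix (path u) (path w)" "prefix (path v) (path w)"
    using assms(1,2) by (auto simp: u v w divides_iff_normal_form strict_prefix_def)
  from prefix_same_cases[OF this(2,3)] consider "strict_prefix (path u) (path v)"
    | "strict_prefix (path v) (path u)" | "path u = path v"
    unfolding strict_prefix_def by metis
  then show ?thesis
    by cases (simp_all add: u v s divides_iff_normal_form linear)
qed

lemma common_multiple_iff_comparable:
  assumes "f \<in> Lambda" "g \<in> Lambda"
  shows "(\<exists>m. common_multiple f g m) \<longleftrightarrow> divides f g \<or> divides g f"
  using assms divisors_comparable divides_refl unfolding common_multiple_def by metis

lemma least_common_multiple_eq:
  assumes "divides f g" "f \<in> Lambda" "g \<in> Lambda"
  shows "least_common_multiple f g = g" "least_common_multiple g f = g"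
  unfolding least_common_multiple_def common_multiple_def
  using assms divides_refl divides_antisym by (blast intro!: the_equality)+

lemma meet_P_P:
  assumes "f \<in> Lambda" "g \<in> Lambda"
  shows "meet (P f) (P g) = (if divides f g then P g else if divides g f then P f else Zero)"
  using assms by (auto simp: common_multiple_iff_comparable least_common_multiple_eq)

section \<open>Filters\<close>

lemma cls_in_Lambda [simp]: "u \<in> words \<Longrightarrow> cls u \<in> Lambda"
  by (simp add: Lambda_eq)

lemma src_in_V: "u \<in> words \<Longrightarrow> src u \<in> V"
  using walk_in_V[OF walk_path] by blast

lemma meet_P_Q:
  assumes "u \<in> words" "i \<in> V"
  shows "meet (P (cls u)) (Q i) = (if src u = i then P (cls u) else Zero)"
    and "meet (Q i) (P (cls u)) = (if src u = i then P (cls u) else Zero)"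
proof -
  have "cls u \<in> Lambda_sup (cls [H i]) \<longleftrightarrow> src u = i"
    using assms composable_cls[of "[H i]" u] append_in_words[of "[H i]" u]
    by (auto simp: Lambda_sup_def)
  then show "meet (P (cls u)) (Q i) = (if src u = i then P (cls u) else Zero)"
    "meet (Q i) (P (cls u)) = (if src u = i then P (cls u) else Zero)" by simp_all
qed

text \<open>From here on meets are computed by the divisibility rules above, not by the existence of common
  multiples.\<close>

declare meet.simps(4-6) [simp del]

lemma E_cases:
  assumes "x \<in> E"
  obtains (Zero) "x = Zero" | (P) u where "u \<in> words" "x = P (cls u)" | (Q) i where "i \<in> V" "x = Q i"
  using assms by (auto simp: E_def Lambda_eq)

lemma filter_comparable:
  assumes "is_filter \<xi>" "P f \<in> \<xi>" "P g \<in> \<xi>"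
  shows "divides f g \<or> divides g f"
proof -
  have "f \<in> Lambda" "g \<in> Lambda" using assms by (auto simp: is_filter_def E_def)
  moreover have "meet (P f) (P g) \<noteq> Zero" using assms unfolding is_filter_def by metis
  ultimately show ?thesis using meet_P_P[of f g] by (auto split: if_splits)
qed

lemma filter_divisor:
  assumes "is_filter \<xi>" "P f \<in> \<xi>" "g \<in> Lambda" "divides g f"
  shows "P g \<in> \<xi>"
proof -
  have f: "f \<in> Lambda" using assms by (auto simp: is_filter_def E_def)
  then have "meet (P f) (P g) = P f" using assms divides_antisym by (auto simp: meet_P_P)
  moreover have "P g \<in> E" using assms by (simp add: E_def)
  ultimately show ?thesis using assms unfolding is_filter_def by blast
qed

lemma filter_source:
  assumes "is_filter \<xi>" "u \<in> words" "P (cls u) \<in> \<xi>"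
  shows "Q (src u) \<in> \<xi>"
proof -
  have "meet (P (cls u)) (Q (src u)) = P (cls u)" using assms src_in_V by (simp add: meet_P_Q)
  moreover have "Q (src u) \<in> E" using assms src_in_V by (simp add: E_def)
  ultimately show ?thesis using assms unfolding is_filter_def by blast
qed

lemma filter_source_unique:
  assumes "is_filter \<xi>" "Q i \<in> \<xi>" "Q j \<in> \<xi>"
  shows "i = j"
proof -
  have "meet (Q i) (Q j) \<noteq> Zero" using assms unfolding is_filter_def by metis
  then show ?thesis by (simp split: if_splits)
qed

lemma filter_has_source:
  assumes "is_filter \<xi>"
  obtains i where "i \<in> V" "Q i \<in> \<xi>"
proof -
  obtain x where x: "x \<in> \<xi>" "x \<in> E" "x \<noteq> Zero" using assms by (auto simp: is_filter_def)
  from x(2) show thesis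
  proof (cases rule: E_cases)
    case (P u)
    then show ?thesis using that filter_source[OF assms P(1)] src_in_V x by blast
  qed (use x that in auto)
qed

section \<open>Filters along infinite paths\<close>

lemma walk_end_unique: "walk i a j \<Longrightarrow> walk i a k \<Longrightarrow> k = j"
  by (cases "a = []") (auto dest: walk_NilD walk_words)

lemma X_A_walk:
  assumes "\<gamma> \<in> X_A"
  shows "walk (src [\<gamma> 0]) (map \<gamma> [0..<n]) (src [\<gamma> n])"
proof -
  obtain e m where em: "\<And>k. \<gamma> k = G (e k) (e (Suc k)) (m k)" "\<And>k. (e k, e (Suc k)) \<in> Omega"
    "\<And>k. 1 \<le> m k" "\<And>k. m k \<le> int (A (e k) (e (Suc k)))"
    using assms unfolding X_A_def by blast
  show ?thesis
  proof (induction n)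
    case 0
    then show ?case using em(1)[of 0] Omega_V[OF em(2)[of 0]] by (simp add: walk_Nil)
  next
    case (Suc n)
    then show ?case using walk_snoc[of "src [\<gamma> 0]" "map \<gamma> [0..<n]" "e n" "e (Suc n)" "m n"] em[of n] em(1)[of "Suc n"]
      by simp
  qed
qed

lemma X_A_if_walks:
  assumes "\<And>n. \<exists>j. walk i (map \<gamma> [0..<n]) j"
  shows "\<gamma> \<in> X_A" "src [\<gamma> 0] = i"
proof -
  obtain e where e: "\<And>n. walk i (map \<gamma> [0..<n]) (e n)" using assms by metis
  have "\<exists>m. \<gamma> n = G (e n) (e (Suc n)) m \<and> (e n, e (Suc n)) \<in> Omega \<and> 1 \<le> m \<and> m \<le> int (A (e n) (e (Suc n)))" for n
  proof -
    have "walk i (map \<gamma> [0..<n] @ [\<gamma> n]) (e (Suc n))" using e[of "Suc n"] by simp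
    then show ?thesis
    proof (rule walk_snocE)
      fix j m
      assume *: "\<gamma> n = G j (e (Suc n)) m" "walk i (map \<gamma> [0..<n]) j" "(j, e (Suc n)) \<in> Omega"
        "1 \<le> m" "m \<le> int (A j (e (Suc n)))"
      have "j = e n" using walk_end_unique[OF e *(2)] .
      then show ?thesis using * by simp
    qed
  qed
  then obtain m where m: "\<And>n. \<gamma> n = G (e n) (e (Suc n)) (m n) \<and> (e n, e (Suc n)) \<in> Omega \<and> 1 \<le> m n
      \<and> m n \<le> int (A (e n) (e (Suc n)))" by metis
  then show "\<gamma> \<in> X_A" unfolding X_A_def by blast
  have "e 0 = i" using e[of 0] walk_NilD by simp
  then show "src [\<gamma> 0] = i" using m[of 0] by simp
qed

text \<open>The carry of \<open>u\<close> is left free: with \<open>l\<close> letters in its path, \<open>u\<close> divides the prefix of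
  \<open>\<gamma>\<close> of length \<open>l + 1\<close>, whatever the carry.\<close>

definition on_path :: "(nat \<Rightarrow> letter) \<Rightarrow> letter list \<Rightarrow> bool" where
  "on_path \<gamma> u \<longleftrightarrow> src u = src [\<gamma> 0] \<and> path u = map \<gamma> [0..<length (path u)]"

definition path_filter :: "(nat \<Rightarrow> letter) \<Rightarrow> idem set" where
  "path_filter \<gamma> = {P (cls u) | u. u \<in> words \<and> on_path \<gamma> u} \<union> {Q (src [\<gamma> 0])}"

lemma path_filter_P [simp]: "u \<in> words \<Longrightarrow> P (cls u) \<in> path_filter \<gamma> \<longleftrightarrow> on_path \<gamma> u"
  by (force simp: path_filter_def on_path_def cls_eq_iff_normal_form)

lemma path_filter_Q [simp]: "Q i \<in> path_filter \<gamma> \<longleftrightarrow> i = src [\<gamma> 0]"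
  and path_filter_Zero [simp]: "Zero \<notin> path_filter \<gamma>"
  by (auto simp: path_filter_def)

lemma take_map_upt: "k \<le> n \<Longrightarrow> take k (map f [0..<n]) = map f [0..<k]"
  by (simp add: take_map)

lemma prefix_map_upt: "prefix b (map f [0..<n]) \<longleftrightarrow> length b \<le> n \<and> b = map f [0..<length b]"
proof
  assume "prefix b (map f [0..<n])"
  then have "length b \<le> n" "b = take (length b) (map f [0..<n])"
    using prefix_length_le by (fastforce, metis append_eq_conv_conj prefix_def)
  then show "length b \<le> n \<and> b = map f [0..<length b]" by (simp add: take_map)
next
  assume "length b \<le> n \<and> b = map f [0..<length b]"
  then show "prefix b (map f [0..<n])" by (metis take_map_upt take_is_prefix)
qed

lemma on_path_divisor:
  assumes "u \<in> words" "v \<in> words" "divides (cls u) (cls v)" "on_path \<gamma> v"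
  shows "on_path \<gamma> u"
proof -
  have "src u = src v" "prefix (path u) (path v)"
    using assms by (auto simp: divides_iff_normal_form strict_prefix_def)
  moreover have "src v = src [\<gamma> 0]" "path v = map \<gamma> [0..<length (path v)]"
    using assms(4) by (auto simp: on_path_def)
  ultimately show ?thesis unfolding on_path_def by (metis prefix_map_upt)
qed

lemma on_path_comparable:
  assumes "u \<in> words" "v \<in> words" "on_path \<gamma> u" "on_path \<gamma> v"
  shows "divides (cls u) (cls v) \<or> divides (cls v) (cls u)"
proof -
  have s: "src u = src v" using assms(3,4) by (simp add: on_path_def)
  have "prefix (path u) (path v) \<or> prefix (path v) (path u)"
    using assms(3,4) prefix_map_upt[of _ \<gamma>] unfolding on_path_def by (metis nat_le_linear)
  then consider "strict_prefix (path u) (path v)" | "strict_prefix (path v) (path u)" | "path u = path v"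
    unfolding strict_prefix_def by metis
  then show ?thesis by cases (simp_all add: assms s divides_iff_normal_form linear)
qed

lemma is_filter_path_filter:
  assumes "\<gamma> \<in> X_A"
  shows "is_filter (path_filter \<gamma>)"
proof -
  let ?i = "src [\<gamma> 0]"
  have V: "?i \<in> V" using X_A_walk[OF assms] walk_in_V by blast
  have sub: "path_filter \<gamma> \<subseteq> E" using V by (auto simp: path_filter_def E_def Lambda_eq)
  have up: "y \<in> path_filter \<gamma>" if x: "x \<in> path_filter \<gamma>" and y: "y \<in> E" and m: "meet x y = x" for x y
  proof -
    have "x \<in> E" using x sub by blast
    then show ?thesis
    proof (cases rule: E_cases)
      case (P u)
      have u: "on_path \<gamma> u" using x P by simp
      from y show ?thesis
      proof (cases rule: E_cases)
        case (P v)
        then have "divides (cls v) (cls u)"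
          using m \<open>x = _\<close> \<open>u \<in> words\<close> by (auto simp: meet_P_P split: if_splits)
        then show ?thesis using on_path_divisor \<open>u \<in> words\<close> P u by simp
      next
        case (Q i)
        then show ?thesis using m P u by (auto simp: meet_P_Q on_path_def split: if_splits)
      qed (use m P in simp)
    next
      case (Q i)
      from y show ?thesis
      proof (cases rule: E_cases)
        case (P v)
        then show ?thesis using m Q by (simp add: meet_P_Q split: if_splits)
      qed (use m Q x in \<open>auto split: if_splits\<close>)
    qed (use x in simp)
  qed
  have meet: "meet x y \<in> path_filter \<gamma>" if x: "x \<in> path_filter \<gamma>" and y: "y \<in> path_filter \<gamma>" for x y
  proof -
    from x consider (P) u where "u \<in> words" "x = P (cls u)" "on_path \<gamma> u" | (Q) "x = Q ?i"
      by (auto simp: path_filter_def)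
    then show ?thesis
    proof cases
      case (P u)
      from y consider (P) v where "v \<in> words" "y = P (cls v)" "on_path \<gamma> v" | (Q) "y = Q ?i"
        by (auto simp: path_filter_def)
      then show ?thesis
      proof cases
        case (P v)
        then show ?thesis using on_path_comparable[of u v \<gamma>] \<open>u \<in> words\<close> \<open>x = P (cls u)\<close> \<open>on_path \<gamma> u\<close>
          by (auto simp: meet_P_P)
      next
        case Q
        then show ?thesis using P V by (simp add: meet_P_Q on_path_def)
      qed
    next
      case Q
      from y consider (P) v where "v \<in> words" "y = P (cls v)" "on_path \<gamma> v" | (Q) "y = Q ?i"
        by (auto simp: path_filter_def)
      then show ?thesis
        by cases (use Q V in \<open>simp_all add: meet_P_Q on_path_def\<close>)
    qed
  qed
  have "path_filter \<gamma> \<noteq> {}" using path_filter_Q by blast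
  then show ?thesis using sub up meet unfolding is_filter_def by simp
qed

lemma path_prefix_words:
  assumes "\<gamma> \<in> X_A" "n \<ge> 1"
  shows "map \<gamma> [0..<n] \<in> words" "src (map \<gamma> [0..<n]) = src [\<gamma> 0]"
    "path (map \<gamma> [0..<n]) = map \<gamma> [0..<n]"
  using walk_words[OF X_A_walk[OF assms(1)], of n] path_walk[OF X_A_walk[OF assms(1)]] assms(2) by simp_all

lemma path_prefix_eq_iff:
  assumes "\<gamma> \<in> X_A" "\<tau> \<in> X_A" "n \<ge> 1"
  shows "path_prefix \<gamma> n = path_prefix \<tau> n \<longleftrightarrow> map \<gamma> [0..<n] = map \<tau> [0..<n]"
proof
  assume "path_prefix \<gamma> n = path_prefix \<tau> n"
  then have "path (map \<gamma> [0..<n]) = path (map \<tau> [0..<n])"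
    unfolding path_prefix_def
    using cls_eq_iff_normal_form[OF path_prefix_words(1)[OF assms(1,3)] path_prefix_words(1)[OF assms(2,3)]]
    by blast
  then show "map \<gamma> [0..<n] = map \<tau> [0..<n]" using path_prefix_words(3) assms by metis
qed (simp only: path_prefix_def)

lemma path_filter_path_prefix:
  assumes "\<gamma> \<in> X_A" "\<tau> \<in> X_A" "n \<ge> 1"
  shows "P (path_prefix \<gamma> n) \<in> path_filter \<tau> \<longleftrightarrow> path_prefix \<tau> n = path_prefix \<gamma> n"
proof -
  note w = path_prefix_words[OF assms(1,3)]
  have "P (path_prefix \<gamma> n) \<in> path_filter \<tau> \<longleftrightarrow>
      src [\<gamma> 0] = src [\<tau> 0] \<and> map \<gamma> [0..<n] = map \<tau> [0..<n]"
    unfolding path_prefix_def path_filter_P[OF w(1)] on_path_def w(2,3) by simp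
  moreover have "src [\<gamma> 0] = src [\<tau> 0]" if "map \<gamma> [0..<n] = map \<tau> [0..<n]"
    using path_prefix_words(2)[OF assms(1,3)] path_prefix_words(2)[OF assms(2,3)] that by simp
  ultimately show ?thesis using path_prefix_eq_iff[OF assms] by auto
qed

lemma on_path_divides_prefix:
  assumes "\<gamma> \<in> X_A" "u \<in> words" "on_path \<gamma> u"
  shows "divides (cls u) (path_prefix \<gamma> (Suc (length (path u))))"
proof -
  let ?n = "Suc (length (path u))"
  have "prefix (path u) (map \<gamma> [0..<?n])" using assms(3) unfolding prefix_map_upt on_path_def by simp
  moreover have "path u \<noteq> map \<gamma> [0..<?n]" by (metis length_map length_upt minus_nat.diff_0 n_not_Suc_n)
  ultimately have "strict_prefix (path u) (map \<gamma> [0..<?n])" by (simp add: strict_prefix_def)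
  then show ?thesis unfolding path_prefix_def
    using divides_iff_normal_form[OF assms(2) path_prefix_words(1)[OF assms(1), of ?n]] path_prefix_words[OF assms(1), of ?n] assms(3)
    by (simp add: on_path_def del: upt_Suc)
qed

text \<open>An element \<open>f\<close> of a larger filter with \<open>l\<close> letters in its path is comparable with the prefix
  of \<open>\<gamma>\<close> of length \<open>l + 1\<close>.  By length \<open>f\<close> must be the divisor, so it lies on \<open>\<gamma>\<close>.\<close>

lemma path_filter_maximal:
  assumes \<gamma>: "\<gamma> \<in> X_A" and \<eta>: "is_filter \<eta>" and sub: "path_filter \<gamma> \<subseteq> \<eta>"
  shows "\<eta> = path_filter \<gamma>"
proof (rule antisym[OF _ sub], rule subsetI)
  fix x assume x: "x \<in> \<eta>"
  have Q: "Q (src [\<gamma> 0]) \<in> \<eta>" using sub path_filter_Q by blast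
  have "x \<in> E" "x \<noteq> Zero" using x \<eta> by (auto simp: is_filter_def)
  then show "x \<in> path_filter \<gamma>"
  proof (cases rule: E_cases)
    case (P u)
    let ?n = "Suc (length (path u))" let ?w = "map \<gamma> [0..<?n]"
    have w: "?w \<in> words" "src ?w = src [\<gamma> 0]" "path ?w = ?w"
      using path_prefix_words[OF \<gamma>, of ?n] by simp_all
    have "P (path_prefix \<gamma> ?n) \<in> path_filter \<gamma>"
      using path_filter_path_prefix[OF \<gamma> \<gamma>, of ?n] by simp
    then have "P (cls ?w) \<in> \<eta>" using sub unfolding path_prefix_def by blast
    then have "divides (cls ?w) (cls u) \<or> divides (cls u) (cls ?w)"
      using filter_comparable[OF \<eta>] x P by blast
    moreover have False if "prefix ?w (path u)" using prefix_length_le[OF that] by simp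
    ultimately have "src u = src [\<gamma> 0]" "prefix (path u) ?w"
      unfolding divides_iff_normal_form[OF w(1) P(1)] divides_iff_normal_form[OF P(1) w(1)] w
      by (auto simp: strict_prefix_def simp del: upt_Suc)
    then have "on_path \<gamma> u" unfolding on_path_def prefix_map_upt by blast
    then show ?thesis using P by simp
  next
    case (Q i)
    then show ?thesis using filter_source_unique[OF \<eta> _ \<open>Q (src [\<gamma> 0]) \<in> \<eta>\<close>] x by simp
  qed simp
qed

lemma walk_continues: "j \<in> V \<Longrightarrow> walk i a j \<Longrightarrow> \<exists>x k. walk i (a @ [x]) k"
proof -
  assume j: "j \<in> V" and w: "walk i a j"
  then obtain k where "(j, k) \<in> Omega" using row_nonzero[of j] by (auto simp: V_def Omega_def)
  then have "walk i (a @ [G j k 1]) k" using walk_snoc[OF w, of k 1] Omega_pos by force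
  then show ?thesis by blast
qed

text \<open>The path is built greedily: as long as some member of the chain is longer than the current
  prefix, follow it (all members agree on the next letter); afterwards continue arbitrarily, which
  is possible since no row of \<open>A\<close> vanishes.\<close>

lemma chain_of_walks_lies_on_path:
  assumes i: "i \<in> V"
    and walks: "\<And>p. p \<in> T \<Longrightarrow> \<exists>j. walk i p j"
    and chain: "\<And>p p'. p \<in> T \<Longrightarrow> p' \<in> T \<Longrightarrow> prefix p p' \<or> prefix p' p"
  obtains \<gamma> where "\<gamma> \<in> X_A" "src [\<gamma> 0] = i" "\<And>p. p \<in> T \<Longrightarrow> p = map \<gamma> [0..<length p]"
proof -
  have ext: "\<exists>x. (\<exists>j. walk i (a @ [x]) j) \<and> (\<forall>p\<in>T. strict_prefix a p \<longrightarrow> prefix (a @ [x]) p)"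
    if a: "\<exists>j. walk i a j" for a
  proof (cases "\<exists>p\<in>T. strict_prefix a p")
    case True
    then obtain p x r where p: "p \<in> T" "p = a @ x # r" by (auto elim: strict_prefixE')
    then have "walk i ((a @ [x]) @ r) j \<Longrightarrow> \<exists>k. walk i (a @ [x]) k" for j by (blast elim: walk_appendE)
    then have "\<exists>k. walk i (a @ [x]) k" using walks[OF p(1)] p(2) by auto
    moreover have "prefix (a @ [x]) p'" if p': "p' \<in> T" "strict_prefix a p'" for p'
    proof -
      obtain x' r' where "p' = a @ x' # r'" using p'(2) by (auto elim: strict_prefixE')
      then show ?thesis using chain[OF p(1) p'(1)] p(2) by auto
    qed
    ultimately show ?thesis by blast
  next
    case False
    then show ?thesis using a walk_continues walk_in_V by blast
  qed
  have "\<exists>f. \<forall>n. (length (f n) = n \<and> (\<exists>j. walk i (f n) j)) \<and>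
      (\<exists>x. f (Suc n) = f n @ [x] \<and> (\<forall>p\<in>T. strict_prefix (f n) p \<longrightarrow> prefix (f n @ [x]) p))"
  proof (rule dependent_nat_choice)
    show "\<exists>a. length a = 0 \<and> (\<exists>j. walk i a j)" using walk_Nil[OF i] by auto
  next
    fix a n assume "length a = n \<and> (\<exists>j. walk i a j)"
    then show "\<exists>b. (length b = Suc n \<and> (\<exists>j. walk i b j)) \<and>
      (\<exists>x. b = a @ [x] \<and> (\<forall>p\<in>T. strict_prefix a p \<longrightarrow> prefix (a @ [x]) p))"
      using ext[of a] by (metis length_append_singleton)
  qed
  then obtain f where len: "\<And>n. length (f n) = n" and walk: "\<And>n. \<exists>j. walk i (f n) j"
    and extend: "\<And>n. \<exists>x. f (Suc n) = f n @ [x] \<and> (\<forall>p\<in>T. strict_prefix (f n) p \<longrightarrow> prefix (f n @ [x]) p)"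
    by blast
  define \<gamma> where "\<gamma> n = last (f (Suc n))" for n
  have f: "f n = map \<gamma> [0..<n]" for n
  proof (induction n)
    case 0
    then show ?case using len[of 0] by simp
  next
    case (Suc n)
    then show ?case using extend[of n] by (auto simp: \<gamma>_def)
  qed
  have "prefix (f n) p" if "p \<in> T" "n \<le> length p" for n p
    using that(2)
  proof (induction n)
    case 0
    then show ?case using len[of 0] by simp
  next
    case (Suc n)
    then have "strict_prefix (f n) p" using len[of n] by (auto simp: strict_prefix_def)
    then show ?case using extend[of n] that(1) by auto
  qed
  then have "p = map \<gamma> [0..<length p]" if "p \<in> T" for p
    using that len[of "length p"] f[of "length p"] by (metis append_eq_conv_conj order_refl prefix_def take_all_iff)
  then show thesis using that[of \<gamma>] X_A_if_walks[of i \<gamma>] walk f by simp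
qed

text \<open>Comparable elements have comparable reduced paths, so the reduced paths that occur in a
  filter form a chain.\<close>

lemma filter_below_path_filter:
  assumes \<xi>: "is_filter \<xi>"
  obtains \<gamma> where "\<gamma> \<in> X_A" "\<xi> \<subseteq> path_filter \<gamma>"
proof -
  obtain i where i: "i \<in> V" "Q i \<in> \<xi>" using filter_has_source[OF \<xi>] .
  have src: "src u = i" if "u \<in> words" "P (cls u) \<in> \<xi>" for u
    using filter_source_unique[OF \<xi> filter_source[OF \<xi> that] i(2)] .
  let ?T = "{path u | u. u \<in> words \<and> P (cls u) \<in> \<xi>}"
  obtain \<gamma> where \<gamma>: "\<gamma> \<in> X_A" "src [\<gamma> 0] = i" "\<And>p. p \<in> ?T \<Longrightarrow> p = map \<gamma> [0..<length p]"
  proof (rule chain_of_walks_lies_on_path[OF i(1), of ?T])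
    fix p assume "p \<in> ?T"
    then show "\<exists>j. walk i p j" using walk_path src by blast
  next
    fix p p' assume "p \<in> ?T" "p' \<in> ?T"
    then obtain u u' where u: "u \<in> words" "P (cls u) \<in> \<xi>" "p = path u"
      and u': "u' \<in> words" "P (cls u') \<in> \<xi>" "p' = path u'" by blast
    show "prefix p p' \<or> prefix p' p"
      using filter_comparable[OF \<xi> u(2) u'(2)] unfolding u(3) u'(3)
        divides_iff_normal_form[OF u(1) u'(1)] divides_iff_normal_form[OF u'(1) u(1)] strict_prefix_def
      by auto
  qed blast
  have "x \<in> path_filter \<gamma>" if x: "x \<in> \<xi>" for x
  proof -
    have "x \<in> E" "x \<noteq> Zero" using x \<xi> by (auto simp: is_filter_def)
    then show ?thesis
    proof (cases rule: E_cases)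
      case (P u)
      then have "path u \<in> ?T" "src u = i" using x src by blast+
      then have "on_path \<gamma> u" using \<gamma>(2) \<gamma>(3)[of "path u"] unfolding on_path_def by argo
      then show ?thesis using P by simp
    next
      case (Q j)
      then show ?thesis using filter_source_unique[OF \<xi> _ i(2)] x \<gamma>(2) by simp
    qed simp
  qed
  then show thesis using that \<gamma>(1) by blast
qed

lemma is_ultrafilter_iff: "is_ultrafilter \<xi> \<longleftrightarrow> (\<exists>\<gamma>\<in>X_A. \<xi> = path_filter \<gamma>)"
proof
  assume "is_ultrafilter \<xi>"
  moreover from this obtain \<gamma> where "\<gamma> \<in> X_A" "\<xi> \<subseteq> path_filter \<gamma>"
    using filter_below_path_filter unfolding is_ultrafilter_def by blast
  ultimately show "\<exists>\<gamma>\<in>X_A. \<xi> = path_filter \<gamma>"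
    using is_filter_path_filter unfolding is_ultrafilter_def by blast
next
  assume "\<exists>\<gamma>\<in>X_A. \<xi> = path_filter \<gamma>"
  then show "is_ultrafilter \<xi>"
    using is_filter_path_filter path_filter_maximal unfolding is_ultrafilter_def by blast
qed

section \<open>Tight filters\<close>

text \<open>The idempotent of the walk \<open>a\<close> starting at \<open>i\<close>; the empty walk is not an element of
  \<open>\<Lambda>\<close>, and \<open>q\<^bsub>h\<^esub>\<close> takes its place, so that steps along a path can be treated uniformly.\<close>

definition node :: "nat \<Rightarrow> letter list \<Rightarrow> idem" where
  "node i a = (if a = [] then Q i else P (cls a))"

definition edges :: "nat \<Rightarrow> letter set" where
  "edges j = {G j k n | k n. (j, k) \<in> Omega \<and> 1 \<le> n \<and> n \<le> int (A j k)}"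

lemma finite_edges:
  assumes "j \<in> V"
  shows "finite (edges j)"
proof -
  let ?K = "{k. 1 \<le> k \<and> enat k \<le> N \<and> A j k \<noteq> 0}"
  have "finite ?K" using assms row_finite_A by (simp add: V_def)
  then have "finite ((\<lambda>(k, n). G j k n) ` (SIGMA k:?K. {1..int (A j k)}))" by blast
  moreover have "edges j \<subseteq> (\<lambda>(k, n). G j k n) ` (SIGMA k:?K. {1..int (A j k)})"
    by (auto simp: edges_def Omega_def V_def)
  ultimately show ?thesis by (rule finite_subset[rotated])
qed

lemma walk_snoc_edge: "walk i a j \<Longrightarrow> x \<in> edges j \<Longrightarrow> \<exists>k. walk i (a @ [x]) k"
  by (auto simp: edges_def intro: walk_snoc)

lemma node_in_E: "walk i a j \<Longrightarrow> node i a \<in> E"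
  using walk_in_V walk_words by (auto simp: node_def E_def Lambda_eq)

lemma node_in_path_filter:
  assumes "walk i a j"
  shows "node i a \<in> path_filter \<gamma> \<longleftrightarrow> i = src [\<gamma> 0] \<and> a = map \<gamma> [0..<length a]"
  using walk_words[OF assms] path_walk[OF assms] by (auto simp: node_def on_path_def)

lemma path_filter_edge:
  assumes "\<gamma> \<in> X_A" "walk i a j" "node i a \<in> path_filter \<gamma>"
  shows "\<exists>x\<in>edges j. node i (a @ [x]) \<in> path_filter \<gamma>"
proof -
  let ?n = "length a"
  have a: "i = src [\<gamma> 0]" "a = map \<gamma> [0..<?n]" using assms node_in_path_filter by auto
  have "walk i (map \<gamma> [0..<Suc ?n]) (src [\<gamma> (Suc ?n)])" using X_A_walk[OF assms(1)] a(1) by blast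
  then have w: "walk i (a @ [\<gamma> ?n]) (src [\<gamma> (Suc ?n)])" using a(2) by simp
  then have "\<gamma> ?n \<in> edges j"
    by (rule walk_snocE) (use walk_end_unique[OF assms(2)] in \<open>auto simp: edges_def\<close>)
  moreover have "node i (a @ [\<gamma> ?n]) \<in> path_filter \<gamma>"
    using node_in_path_filter[OF w] a by simp
  ultimately show ?thesis by blast
qed

lemma character_eq_1_iff: "e \<in> E \<Longrightarrow> character \<xi> e = 1 \<longleftrightarrow> e \<in> \<xi>"
  and character_eq_0_iff: "e \<in> E \<Longrightarrow> character \<xi> e = 0 \<longleftrightarrow> e \<notin> \<xi>"
  by (simp_all add: character_def)

lemma continuous_map_evaluation:
  assumes "e \<in> E"
  shows "continuous_map character_space (discrete_topology {0, 1}) (\<lambda>\<phi>. \<phi> e)"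
  unfolding character_space_def
  by (rule continuous_map_from_subtopology[OF continuous_map_product_projection[OF assms]])

text \<open>The characters of filters that contain an edge prolonging \<open>a\<close> as soon as they contain \<open>a\<close>
  form a closed set, because finitely many edges leave a vertex.  It contains the characters of all
  ultrafilters, hence all tight characters.\<close>

lemma tight_edge:
  assumes \<xi>: "is_filter \<xi>" and tight: "character \<xi> \<in> E_tight"
    and w: "walk i a j" and a: "node i a \<in> \<xi>"
  shows "\<exists>x\<in>edges j. node i (a @ [x]) \<in> \<xi>"
proof -
  let ?K = "{\<phi> \<in> topspace character_space. \<phi> (node i a) = 0} \<union>
    (\<Union>x\<in>edges j. {\<phi> \<in> topspace character_space. \<phi> (node i (a @ [x])) = 1})"
  have E: "node i a \<in> E" "\<And>x. x \<in> edges j \<Longrightarrow> node i (a @ [x]) \<in> E"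
    using node_in_E w walk_snoc_edge[OF w] by blast+
  have cl: "closedin character_space {\<phi> \<in> topspace character_space. \<phi> e = b}"
    if "e \<in> E" "b \<in> {0, 1}" for e and b :: nat
    using closedin_continuous_map_preimage[OF continuous_map_evaluation[OF that(1)], of "{b}"] that(2)
    by simp
  have K: "closedin character_space ?K"
    using finite_edges[of j] walk_in_V[OF w] E
    by (intro closedin_Un closedin_Union) (auto intro!: cl)
  have "{character \<xi> | \<xi>. is_ultrafilter \<xi>} \<subseteq> ?K"
  proof
    fix \<phi> assume "\<phi> \<in> {character \<xi> | \<xi>. is_ultrafilter \<xi>}"
    then obtain \<gamma> where \<gamma>: "\<gamma> \<in> X_A" "\<phi> = character (path_filter \<gamma>)"
      by (auto simp: is_ultrafilter_iff)
    then have "\<phi> \<in> topspace character_space"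
      using is_filter_path_filter topspace_character_space by blast
    then show "\<phi> \<in> ?K" using path_filter_edge[OF \<gamma>(1) w] E
      by (cases "node i a \<in> path_filter \<gamma>") (auto simp: \<gamma>(2) character_eq_1_iff[simplified] character_eq_0_iff)
  qed
  then have "E_tight \<subseteq> ?K" unfolding E_tight_def by (rule closure_of_minimal[OF _ K])
  then have "character \<xi> \<in> ?K" using tight by blast
  then show ?thesis using E a by (auto simp: character_eq_1_iff[simplified] character_eq_0_iff)
qed

text \<open>For a tight filter below \<open>path_filter \<gamma>\<close>, \<open>tight_edge\<close> produces longer and longer paths in the
  filter.  They all lie on \<open>\<gamma>\<close>, so every prefix of \<open>\<gamma>\<close> occurs and the two filters agree.\<close>

lemma E_tight_eq: "E_tight = (\<lambda>\<gamma>. character (path_filter \<gamma>)) ` X_A"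
proof
  have "{character \<xi> | \<xi>. is_ultrafilter \<xi>} \<subseteq> topspace character_space"
    by (auto simp: topspace_character_space is_ultrafilter_def)
  from closure_of_subset[OF this] show "(\<lambda>\<gamma>. character (path_filter \<gamma>)) ` X_A \<subseteq> E_tight"
    unfolding E_tight_def by (auto simp: is_ultrafilter_iff)
next
  show "E_tight \<subseteq> (\<lambda>\<gamma>. character (path_filter \<gamma>)) ` X_A"
  proof
    fix \<phi> assume \<phi>: "\<phi> \<in> E_tight"
    then have "\<phi> \<in> topspace character_space"
      unfolding E_tight_def using closure_of_subset_topspace[of character_space] by blast
    then obtain \<xi> where \<xi>: "is_filter \<xi>" "\<phi> = character \<xi>" by (auto simp: topspace_character_space)
    obtain \<gamma> where \<gamma>: "\<gamma> \<in> X_A" "\<xi> \<subseteq> path_filter \<gamma>" using filter_below_path_filter[OF \<xi>(1)] .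
    let ?i = "src [\<gamma> 0]"
    have nodes: "node ?i (map \<gamma> [0..<n]) \<in> \<xi>" for n
    proof (induction n)
      case 0
      obtain i where "i \<in> V" "Q i \<in> \<xi>" using filter_has_source[OF \<xi>(1)] .
      then show ?case using \<gamma>(2) by (auto simp: node_def)
    next
      case (Suc n)
      have w: "walk ?i (map \<gamma> [0..<n]) (src [\<gamma> n])" by (rule X_A_walk[OF \<gamma>(1)])
      from tight_edge[OF \<xi>(1) \<phi>[unfolded \<xi>(2)] w Suc] obtain x
        where x: "x \<in> edges (src [\<gamma> n])" "node ?i (map \<gamma> [0..<n] @ [x]) \<in> \<xi>" by blast
      obtain k where "walk ?i (map \<gamma> [0..<n] @ [x]) k" using walk_snoc_edge[OF w x(1)] by blast
      then have "map \<gamma> [0..<n] @ [x] = map \<gamma> [0..<Suc n]"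
        using node_in_path_filter[of ?i "map \<gamma> [0..<n] @ [x]" k \<gamma>] x(2) \<gamma>(2) by auto
      then show ?case using x(2) by simp
    qed
    have "path_filter \<gamma> \<subseteq> \<xi>"
    proof
      fix x assume "x \<in> path_filter \<gamma>"
      then consider (P) u where "u \<in> words" "x = P (cls u)" "on_path \<gamma> u" | (Q) "x = Q ?i"
        by (auto simp: path_filter_def)
      then show "x \<in> \<xi>"
      proof cases
        case (P u)
        let ?n = "Suc (length (path u))"
        have "P (path_prefix \<gamma> ?n) \<in> \<xi>" using nodes[of ?n] by (simp add: node_def path_prefix_def)
        then show ?thesis
          using filter_divisor[OF \<xi>(1)] on_path_divides_prefix[OF \<gamma>(1) P(1,3)] P by simp
      next
        case Q
        then show ?thesis using nodes[of 0] by (simp add: node_def)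
      qed
    qed
    then have "\<xi> = path_filter \<gamma>" using \<gamma>(2) by blast
    then show "\<phi> \<in> (\<lambda>\<gamma>. character (path_filter \<gamma>)) ` X_A" using \<gamma>(1) \<xi>(2) by simp
  qed
qed

section \<open>The homeomorphism\<close>

lemma path_eqI:
  assumes "\<gamma> \<in> X_A" "\<tau> \<in> X_A" "\<And>n. n \<ge> 1 \<Longrightarrow> path_prefix \<gamma> n = path_prefix \<tau> n"
  shows "\<gamma> = \<tau>"
proof
  fix k
  have "map \<gamma> [0..<Suc k] = map \<tau> [0..<Suc k]" using path_prefix_eq_iff[of \<gamma> \<tau> "Suc k"] assms by simp
  then show "\<gamma> k = \<tau> k" by simp
qed

lemma Phi_path_filter:
  assumes "\<gamma> \<in> X_A"
  shows "Phi (character (path_filter \<gamma>)) = \<gamma>"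
  unfolding Phi_character[OF is_filter_path_filter[OF assms]] stem_path_def
proof (rule the_equality)
  show "\<gamma> \<in> X_A \<and> (\<forall>k\<ge>1. path_prefix \<gamma> k \<in> stem (path_filter \<gamma>))"
    using assms path_filter_path_prefix[OF assms assms] path_prefix_words(1)[OF assms]
    by (auto simp: stem_def path_prefix_def)
next
  fix \<tau> assume \<tau>: "\<tau> \<in> X_A \<and> (\<forall>k\<ge>1. path_prefix \<tau> k \<in> stem (path_filter \<gamma>))"
  then have "path_prefix \<tau> k = path_prefix \<gamma> k" if "k \<ge> 1" for k
    using path_filter_path_prefix[of \<tau> \<gamma> k] assms that by (simp add: stem_def)
  then show "\<tau> = \<gamma>" using path_eqI \<tau> assms by blast
qed

text \<open>For \<open>p\<^sub>f\<close> the cylinder has one letter more than the path of \<open>f\<close>, because that path may be empty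
  and cylinders have positive length.\<close>

lemma path_filter_locally_constant:
  assumes "\<gamma> \<in> X_A" "e \<in> E"
  obtains n where "n \<ge> 1" "\<forall>\<tau> \<in> cylinder n \<gamma>. e \<in> path_filter \<tau> \<longleftrightarrow> e \<in> path_filter \<gamma>"
proof -
  have cyl: "map \<tau> [0..<n] = map \<gamma> [0..<n]" "src [\<tau> 0] = src [\<gamma> 0]"
    if "\<tau> \<in> cylinder n \<gamma>" "n \<ge> 1" for \<tau> n
    using that path_prefix_eq_iff[of \<tau> \<gamma> n] assms(1) path_prefix_words(2)[of \<tau> n] path_prefix_words(2)[of \<gamma> n]
    unfolding cylinder_def by auto
  from assms(2) show thesis
  proof (cases rule: E_cases)
    case Zero
    then show ?thesis using that[of 1] by simp
  next
    case (P u)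
    let ?n = "Suc (length (path u))"
    have "on_path \<tau> u \<longleftrightarrow> on_path \<gamma> u" if "\<tau> \<in> cylinder ?n \<gamma>" for \<tau>
    proof -
      have "map \<tau> [0..<length (path u)] = map \<gamma> [0..<length (path u)]" using cyl(1)[OF that] by simp
      moreover have "src [\<tau> 0] = src [\<gamma> 0]" using cyl(2)[OF that] by simp
      ultimately show ?thesis by (simp only: on_path_def)
    qed
    then show ?thesis using that[of ?n] P by simp
  next
    case (Q i)
    then show ?thesis using that[of 1] cyl(2)[of _ 1] by simp
  qed
qed

lemma openin_cylinder: "\<gamma> \<in> X_A \<Longrightarrow> n \<ge> 1 \<Longrightarrow> openin path_space (cylinder n \<gamma>)"
  unfolding path_space_def by (rule topology_generated_by_Basis) blast

lemma continuous_map_Phi: "continuous_map tight_space path_space Phi"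
  unfolding path_space_def
proof (rule continuous_on_generated_topo)
  fix U assume "U \<in> {cylinder n \<gamma> | n \<gamma>. n \<ge> 1 \<and> \<gamma> \<in> X_A}"
  then obtain n \<gamma> where U: "U = cylinder n \<gamma>" "n \<ge> 1" "\<gamma> \<in> X_A" by blast
  let ?e = "P (path_prefix \<gamma> n)"
  have e: "?e \<in> E" using path_prefix_words(1)[OF U(3,2)] by (simp add: E_def path_prefix_def)
  have "continuous_map tight_space (discrete_topology {0, 1}) (\<lambda>\<phi>. \<phi> ?e)"
    unfolding tight_space_def by (rule continuous_map_from_subtopology[OF continuous_map_evaluation[OF e]])
  then have "openin tight_space {\<phi> \<in> topspace tight_space. \<phi> ?e \<in> {1}}"
    by (rule openin_continuous_map_preimage) simp
  also have "{\<phi> \<in> topspace tight_space. \<phi> ?e \<in> {1}} = Phi -` U \<inter> topspace tight_space"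
    using U(2,3) e
    by (auto simp: topspace_tight_space E_tight_eq Phi_path_filter character_eq_1_iff[simplified]
        path_filter_path_prefix U(1) cylinder_def)
  finally show "openin tight_space (Phi -` U \<inter> topspace tight_space)" .
next
  have "\<Union> {cylinder n \<gamma> | n \<gamma>. n \<ge> 1 \<and> \<gamma> \<in> X_A} = X_A"
    using topspace_path_space unfolding path_space_def by simp
  then show "Phi ` topspace tight_space \<subseteq> \<Union> {cylinder n \<gamma> | n \<gamma>. n \<ge> 1 \<and> \<gamma> \<in> X_A}"
    by (auto simp: topspace_tight_space E_tight_eq Phi_path_filter)
qed

lemma continuous_map_character_path_filter:
  "continuous_map path_space tight_space (\<lambda>\<gamma>. character (path_filter \<gamma>))"
  unfolding tight_space_def character_space_def continuous_map_in_subtopology continuous_map_componentwise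
proof (intro conjI ballI)
  show "(\<lambda>\<gamma>. character (path_filter \<gamma>)) ` topspace path_space \<subseteq> extensional E"
    by (auto simp: character_def)
  show "(\<lambda>\<gamma>. character (path_filter \<gamma>)) \<in> topspace path_space \<rightarrow> {character \<xi> | \<xi>. is_filter \<xi>}"
    using is_filter_path_filter by (auto simp: topspace_path_space)
  show "(\<lambda>\<gamma>. character (path_filter \<gamma>)) \<in> topspace path_space \<rightarrow> E_tight"
    by (auto simp: topspace_path_space E_tight_eq)
next
  fix e assume e: "e \<in> E"
  show "continuous_map path_space (discrete_topology {0, 1}) (\<lambda>\<gamma>. character (path_filter \<gamma>) e)"
    unfolding continuous_map_def
  proof (intro conjI allI impI)
    show "(\<lambda>\<gamma>. character (path_filter \<gamma>) e) \<in> topspace path_space \<rightarrow> topspace (discrete_topology {0, 1})"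
      using e by (simp add: character_def)
    fix U
    show "openin path_space {\<gamma> \<in> topspace path_space. character (path_filter \<gamma>) e \<in> U}"
      unfolding topspace_path_space
    proof (subst openin_subopen, rule ballI)
      fix \<gamma> assume \<gamma>: "\<gamma> \<in> {\<gamma> \<in> X_A. character (path_filter \<gamma>) e \<in> U}"
      then have "\<gamma> \<in> X_A" by simp
      from path_filter_locally_constant[OF this e] obtain n where n: "n \<ge> 1"
        "\<forall>\<tau> \<in> cylinder n \<gamma>. e \<in> path_filter \<tau> \<longleftrightarrow> e \<in> path_filter \<gamma>" .
      have "cylinder n \<gamma> \<subseteq> {\<gamma> \<in> X_A. character (path_filter \<gamma>) e \<in> U}"
      proof
        fix \<tau> assume \<tau>: "\<tau> \<in> cylinder n \<gamma>"
        have "character (path_filter \<tau>) e = character (path_filter \<gamma>) e"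
          using e n(2) \<tau> by (simp add: character_def)
        then show "\<tau> \<in> {\<gamma> \<in> X_A. character (path_filter \<gamma>) e \<in> U}"
          using \<gamma> \<tau> by (simp add: cylinder_def)
      qed
      moreover have "\<gamma> \<in> cylinder n \<gamma>" using \<gamma> by (simp add: cylinder_def)
      ultimately show "\<exists>T. openin path_space T \<and> \<gamma> \<in> T \<and> T \<subseteq> {\<gamma> \<in> X_A. character (path_filter \<gamma>) e \<in> U}"
        using openin_cylinder n(1) \<gamma> by blast
    qed
  qed
qed

theorem homeomorphic_map_Phi: "homeomorphic_map tight_space path_space Phi"
proof -
  have "homeomorphic_maps tight_space path_space Phi (\<lambda>\<gamma>. character (path_filter \<gamma>))"
    unfolding homeomorphic_maps_def
    using continuous_map_Phi continuous_map_character_path_filter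
    by (auto simp: topspace_tight_space topspace_path_space E_tight_eq Phi_path_filter)
  then show ?thesis by (rule homeomorphic_maps_imp_map)
qed

end

theorem proposition5p12:
  fixes N :: enat and A :: "nat \<Rightarrow> nat \<Rightarrow> nat" and B :: "nat \<Rightarrow> nat \<Rightarrow> int"
  assumes "katsura_data N A B"
  shows "homeomorphic_map (katsura_data.tight_space N A B) (katsura_data.path_space N A B)
           (katsura_data.Phi N A B)"
  by (rule katsura_data.homeomorphic_map_Phi[OF assms])

end
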